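(* Let $(S,\cdot)$ be a left amenable semigroup, and let $h$ be a homomorphism from $S$ onto a semigroup $(T,\cdot)$. Then $\widetilde h[\Delta^*(S)]=\Delta^*(T)$.
   Context: A semigroup is left amenable if it admits a left invariant mean, i.e. a positive norm-one linear functional $\mu$ on $l_\infty(S)$ with $\mu(g\circ\lambda_s)=\mu(g)$ for all $s\in S$, $g\in l_\infty(S)$ (where $\lambda_s(x)=sx$). For a left amenable semigroup $S$ and $A\subseteq S$, the Banach density is $d^*(A)=\sup\{\lambda(\chi_A):\lambda$ a left invariant mean on $S\}$. The Stone–Čech compactification $\beta S$ is the set of ultrafilters on $S$, and $\Delta^*(S)=\{p\in\beta S: d^*(A)>0$ for all $A\in p\}$. Here $\widetilde h:\beta S\to\beta T$ denotes the continuous extension of $h$ (a surjective homomorphism of $\beta S$ onto $\beta T$). Since $T$ is a homomorphic image of a left amenable semigroup, $T$ is left amenable, so $\Delta^*(T)$ is defined. *)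

theory Defs
  imports "HOL-Analysis.Analysis"
begin

section \<open>Left invariant means and Banach density\<close>

text \<open>The underlying set of a semigroup is a whole type of class \<open>semigroup_mult\<close>.  An element
  of the dual of \<open>l_infty\<close> is represented by a function on all real-valued functions; only its
  values on bounded functions are ever used.\<close>

definition l_infty :: "('a \<Rightarrow> real) set" where
  "l_infty = {g. bounded (range g)}"

definition sup_norm :: "('a \<Rightarrow> real) \<Rightarrow> real" where
  "sup_norm g = (SUP x. \<bar>g x\<bar>)"

definition linear_functional :: "(('a \<Rightarrow> real) \<Rightarrow> real) \<Rightarrow> bool" where
  "linear_functional \<mu> \<longleftrightarrow>
     (\<forall>f\<in>l_infty. \<forall>g\<in>l_infty. \<mu> (\<lambda>x. f x + g x) = \<mu> f + \<mu> g) \<and>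
     (\<forall>c. \<forall>g\<in>l_infty. \<mu> (\<lambda>x. c * g x) = c * \<mu> g)"

text \<open>The boundedness clause is needed because \<open>Sup\<close> of an unbounded set of reals is
  unspecified.\<close>

definition has_dual_norm :: "(('a \<Rightarrow> real) \<Rightarrow> real) \<Rightarrow> real \<Rightarrow> bool" where
  "has_dual_norm \<mu> r \<longleftrightarrow>
     bdd_above {\<bar>\<mu> g\<bar> | g. g \<in> l_infty \<and> sup_norm g \<le> 1} \<and>
     Sup {\<bar>\<mu> g\<bar> | g. g \<in> l_infty \<and> sup_norm g \<le> 1} = r"

definition is_mean :: "(('a \<Rightarrow> real) \<Rightarrow> real) \<Rightarrow> bool" where
  "is_mean \<mu> \<longleftrightarrow> linear_functional \<mu> \<and> has_dual_norm \<mu> 1 \<and>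
     (\<forall>g\<in>l_infty. (\<forall>x. 0 \<le> g x) \<longrightarrow> 0 \<le> \<mu> g)"

definition left_invariant_mean :: "(('a::semigroup_mult \<Rightarrow> real) \<Rightarrow> real) \<Rightarrow> bool" where
  "left_invariant_mean \<mu> \<longleftrightarrow> is_mean \<mu> \<and>
     (\<forall>s. \<forall>g\<in>l_infty. \<mu> (g \<circ> (\<lambda>x. s * x)) = \<mu> g)"

definition left_amenable :: "'a::semigroup_mult itself \<Rightarrow> bool" where
  "left_amenable _ \<longleftrightarrow> (\<exists>\<mu> :: ('a \<Rightarrow> real) \<Rightarrow> real. left_invariant_mean \<mu>)"

text \<open>Meaningful for left amenable semigroups only: otherwise this is \<open>Sup {}\<close>.\<close>

definition banach_density :: "'a::semigroup_mult set \<Rightarrow> real" where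
  "banach_density A = Sup {\<mu> (indicat_real A) | \<mu>. left_invariant_mean \<mu>}"


section \<open>The Stone--Cech compactification of a discrete space\<close>

text \<open>\<open>A \<in> p\<close> is rendered as \<open>eventually (\<lambda>x. x \<in> A) p\<close>.  The library orders filters by
  refinement (\<open>q \<le> p\<close> means that \<open>q\<close> contains every member of \<open>p\<close>) and admits the improper
  filter \<open>bot\<close>, so ultrafilters are the minimal elements above \<open>bot\<close>.\<close>

definition ultrafilter :: "'a filter \<Rightarrow> bool" where
  "ultrafilter p \<longleftrightarrow> p \<noteq> bot \<and> (\<forall>q. q \<noteq> bot \<and> q \<le> p \<longrightarrow> q = p)"

definition beta :: "'a filter set" where
  "beta = {p. ultrafilter p}"

definition beta_hat :: "'a set \<Rightarrow> 'a filter set" where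
  "beta_hat A = {p \<in> beta. eventually (\<lambda>x. x \<in> A) p}"

definition beta_topology :: "'a filter topology" where
  "beta_topology = topology_generated_by (range beta_hat)"

text \<open>The continuous extension of \<open>h\<close>, where \<open>x\<close> is identified with the principal ultrafilter
  \<open>principal {x}\<close>.  Extensionality pins down the value outside \<open>beta\<close>.\<close>

definition beta_ext :: "('a \<Rightarrow> 'b) \<Rightarrow> 'a filter \<Rightarrow> 'b filter" where
  "beta_ext h = (THE g. g \<in> extensional beta \<and>
     continuous_map beta_topology beta_topology g \<and>
     (\<forall>x. g (principal {x}) = principal {h x}))"

definition Delta_star :: "'a::semigroup_mult filter set" where
  "Delta_star = {p \<in> beta. \<forall>A. eventually (\<lambda>x. x \<in> A) p \<longrightarrow> banach_density A > 0}"


section \<open>Existence and uniqueness of the continuous extension\<close>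

lemma ultrafilter_iff:
  "ultrafilter p \<longleftrightarrow> p \<noteq> bot \<and> (\<forall>A. eventually (\<lambda>x. x \<in> A) p \<or> eventually (\<lambda>x. x \<notin> A) p)"
proof (intro iffI conjI allI)
  assume u: "ultrafilter p"
  then show "p \<noteq> bot" by (simp add: ultrafilter_def)
  fix A
  show "eventually (\<lambda>x. x \<in> A) p \<or> eventually (\<lambda>x. x \<notin> A) p"
  proof (cases "inf p (principal A) = bot")
    case True
    then have "eventually (\<lambda>x. False) (inf p (principal A))" by simp
    then show ?thesis by (simp add: eventually_inf_principal)
  next
    case False
    then have "inf p (principal A) = p" using u by (simp add: ultrafilter_def)
    moreover have "eventually (\<lambda>x. x \<in> A) (inf p (principal A))"
      by (simp add: eventually_inf_principal)
    ultimately show ?thesis by simp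
  qed
next
  assume a: "p \<noteq> bot \<and> (\<forall>A. eventually (\<lambda>x. x \<in> A) p \<or> eventually (\<lambda>x. x \<notin> A) p)"
  have "q = p" if q: "q \<noteq> bot" "q \<le> p" for q
  proof (rule antisym[OF q(2)])
    show "p \<le> q"
      unfolding le_filter_def
    proof (intro allI impI)
      fix P assume P: "eventually P q"
      show "eventually P p"
      proof (rule ccontr)
        assume "\<not> eventually P p"
        then have "eventually (\<lambda>x. \<not> P x) p" using a[THEN conjunct2, rule_format, of "Collect P"] by simp
        then have "eventually (\<lambda>x. \<not> P x) q" using q(2) by (simp add: le_filter_def)
        with P have "eventually (\<lambda>x. False) q" by (auto elim: eventually_elim2)
        with q(1) show False by (simp add: trivial_limit_def)
      qed
    qed
  qed
  with a show "ultrafilter p" by (auto simp: ultrafilter_def)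
qed

lemma principal_in_beta: "principal {x} \<in> beta"
  by (auto simp: beta_def ultrafilter_iff eventually_principal principal_eq_bot_iff)

lemma filtermap_in_beta: "p \<in> beta \<Longrightarrow> filtermap h p \<in> beta"
proof -
  assume "p \<in> beta"
  then have p: "p \<noteq> bot" "\<And>A. eventually (\<lambda>x. x \<in> A) p \<or> eventually (\<lambda>x. x \<notin> A) p"
    by (auto simp: beta_def ultrafilter_iff)
  show ?thesis
    using p(1) p(2)[of "h -` A" for A]
    by (auto simp: beta_def ultrafilter_iff eventually_filtermap filtermap_bot_iff)
qed

lemma topspace_beta [simp]: "topspace beta_topology = beta"
proof -
  have "\<Union> (range beta_hat) = beta"
  proof
    show "\<Union> (range beta_hat) \<subseteq> beta" by (auto simp: beta_hat_def)
    have "beta_hat UNIV = beta" by (simp add: beta_hat_def)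
    then show "beta \<subseteq> \<Union> (range beta_hat)" by blast
  qed
  then show ?thesis by (simp only: beta_topology_def topology_generated_by_topspace)
qed

lemma openin_beta_hat: "openin beta_topology (beta_hat A)"
  unfolding beta_topology_def by (rule topology_generated_by_Basis) simp

lemma openin_beta_basis:
  assumes "openin beta_topology U" "p \<in> U"
  shows "\<exists>A. p \<in> beta_hat A \<and> beta_hat A \<subseteq> U"
proof -
  have "generate_topology_on (range beta_hat) U"
    using assms(1) by (simp add: beta_topology_def openin_topology_generated_by)
  then show ?thesis using assms(2)
  proof (induction arbitrary: p)
    case Empty then show ?case by simp
  next
    case (Int a b)
    then obtain A B where "p \<in> beta_hat A" "beta_hat A \<subseteq> a" "p \<in> beta_hat B" "beta_hat B \<subseteq> b"
      by (meson IntE)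
    moreover have "beta_hat (A \<inter> B) = beta_hat A \<inter> beta_hat B"
      by (auto simp: beta_hat_def eventually_conj_iff)
    ultimately show ?case by (intro exI[of _ "A \<inter> B"]) auto
  next
    case (UN K) then show ?case by (meson UnionE Union_upper subset_trans)
  next
    case (Basis s) then show ?case by auto
  qed
qed

lemma principal_dense:
  assumes "openin beta_topology U" "U \<noteq> {}"
  shows "\<exists>x. principal {x} \<in> U"
proof -
  obtain p where "p \<in> U" using assms(2) by blast
  then obtain A where A: "p \<in> beta_hat A" "beta_hat A \<subseteq> U"
    using openin_beta_basis[OF assms(1)] by blast
  have "A \<noteq> {}"
    using A(1) by (auto simp: beta_hat_def beta_def ultrafilter_iff)
  then obtain x where "x \<in> A" by blast
  then have "principal {x} \<in> beta_hat A"
    by (simp add: beta_hat_def principal_in_beta eventually_principal)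
  with A(2) show ?thesis by blast
qed

lemma continuous_map_filtermap:
  "continuous_map beta_topology beta_topology (restrict (filtermap h) beta)"
proof -
  have "openin beta_topology {p \<in> beta. restrict (filtermap h) beta p \<in> U}"
    if U: "openin beta_topology U" for U
  proof (subst openin_subopen, intro ballI)
    fix p assume "p \<in> {p \<in> beta. restrict (filtermap h) beta p \<in> U}"
    then have p: "p \<in> beta" "filtermap h p \<in> U" by auto
    then obtain A where A: "filtermap h p \<in> beta_hat A" "beta_hat A \<subseteq> U"
      using openin_beta_basis[OF U] by blast
    have "beta_hat (h -` A) \<subseteq> {p \<in> beta. restrict (filtermap h) beta p \<in> U}"
      using A(2) by (auto simp: beta_hat_def eventually_filtermap filtermap_in_beta)
    moreover have "p \<in> beta_hat (h -` A)"
      using A(1) p(1) by (simp add: beta_hat_def eventually_filtermap)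
    ultimately show "\<exists>T. openin beta_topology T \<and> p \<in> T \<and>
        T \<subseteq> {p \<in> beta. restrict (filtermap h) beta p \<in> U}"
      using openin_beta_hat by blast
  qed
  then show ?thesis
    by (auto simp: continuous_map_def filtermap_in_beta)
qed

lemma continuous_extension_unique:
  assumes g: "continuous_map beta_topology beta_topology g"
    and gh: "\<And>x. g (principal {x}) = principal {h x}"
    and p: "p \<in> beta"
  shows "g p = filtermap h p"
proof -
  have gp: "g p \<in> beta" using g p by (auto simp: continuous_map_def)
  have "eventually P (filtermap h p)" if P: "eventually P (g p)" for P
  proof (rule ccontr)
    assume "\<not> eventually P (filtermap h p)"
    then have "\<not> eventually (\<lambda>x. x \<in> {x. P (h x)}) p" by (simp add: eventually_filtermap)
    then have np: "eventually (\<lambda>x. x \<notin> {x. P (h x)}) p"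
      using p unfolding beta_def ultrafilter_iff by blast
    let ?U = "{q \<in> beta. g q \<in> beta_hat (Collect P)} \<inter> beta_hat {x. \<not> P (h x)}"
    have "openin beta_topology ?U"
      using openin_continuous_map_preimage[OF g openin_beta_hat[of "Collect P"]] openin_beta_hat
      by (auto intro: openin_Int)
    moreover have "p \<in> ?U" using p gp P np by (simp add: beta_hat_def)
    ultimately obtain x where "principal {x} \<in> ?U" using principal_dense by blast
    then show False by (auto simp: beta_hat_def gh eventually_principal)
  qed
  then have "filtermap h p \<le> g p" by (simp add: le_filter_def)
  then show ?thesis
    using gp filtermap_in_beta[OF p, of h] by (auto simp: beta_def ultrafilter_def)
qed

lemma beta_ext_eq: "beta_ext h = restrict (filtermap h) beta"
  unfolding beta_ext_def
proof (rule the_equality)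
  show "restrict (filtermap h) beta \<in> extensional beta \<and>
     continuous_map beta_topology beta_topology (restrict (filtermap h) beta) \<and>
     (\<forall>x. restrict (filtermap h) beta (principal {x}) = principal {h x})"
    by (simp add: continuous_map_filtermap principal_in_beta filtermap_principal)
next
  fix g assume g: "g \<in> extensional beta \<and> continuous_map beta_topology beta_topology g \<and>
     (\<forall>x. g (principal {x}) = principal {h x})"
  show "g = restrict (filtermap h) beta"
    by (rule extensionalityI[of _ beta]) (use g in \<open>auto intro: continuous_extension_unique\<close>)
qed

end

theory Submission
  imports Defs
begin

text \<open>Left invariant means on \<open>S\<close> push forward along \<open>h\<close> to left invariant means on \<open>T\<close>.
  Conversely, let \<open>\<nu>\<close> be a left invariant mean on \<open>T\<close>, \<open>k\<close> a set-theoretic section of \<open>h\<close> and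
  \<open>l\<close> a left invariant mean on \<open>S\<close>. Averaging the mean \<open>f \<mapsto> \<nu> (f \<circ> k)\<close> over its translates with
  \<open>l\<close> (an Arens product) makes it left invariant without changing its push-forward \<open>\<nu>\<close>. Hence
  \<open>B\<close> and \<open>h -` B\<close> simultaneously have positive Banach density. Null sets form an ideal, so the
  filter base of preimages of members of some \<open>q \<in> Delta_star\<close> extends to an ultrafilter that
  avoids all null sets; such an ultrafilter lies in \<open>Delta_star\<close> and is mapped to \<open>q\<close>.\<close>

section \<open>Means\<close>

lemma l_infty_iff: "g \<in> l_infty \<longleftrightarrow> (\<exists>C. \<forall>x. \<bar>g x\<bar> \<le> C)"
  by (simp add: l_infty_def bounded_iff)

lemma l_infty_const [simp]: "(\<lambda>x. c) \<in> l_infty"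
  by (auto simp: l_infty_iff)

lemma l_infty_indicator [simp]: "indicat_real A \<in> l_infty"
  unfolding l_infty_iff by (rule exI[of _ 1]) (simp add: indicator_def)

lemma l_infty_comp [simp]: "g \<in> l_infty \<Longrightarrow> (\<lambda>x. g (f x)) \<in> l_infty"
  by (auto simp: l_infty_iff)

lemma l_infty_add [simp]:
  assumes "f \<in> l_infty" "g \<in> l_infty"
  shows "(\<lambda>x. f x + g x) \<in> l_infty"
proof -
  obtain C D where "\<And>x. \<bar>f x\<bar> \<le> C" "\<And>x. \<bar>g x\<bar> \<le> D"
    using assms by (auto simp: l_infty_iff)
  then have "\<bar>f x + g x\<bar> \<le> C + D" for x
    by (meson abs_triangle_ineq add_mono order_trans)
  then show ?thesis by (auto simp: l_infty_iff)
qed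

lemma l_infty_cmult [simp]:
  assumes "g \<in> l_infty"
  shows "(\<lambda>x. c * g x) \<in> l_infty"
proof -
  obtain C where "\<And>x. \<bar>g x\<bar> \<le> C" using assms by (auto simp: l_infty_iff)
  then have "\<bar>c * g x\<bar> \<le> \<bar>c\<bar> * C" for x by (simp add: abs_mult mult_left_mono)
  then show ?thesis by (auto simp: l_infty_iff)
qed

lemma abs_le_sup_norm:
  assumes "g \<in> l_infty"
  shows "\<bar>g x\<bar> \<le> sup_norm g"
proof -
  have "bdd_above (range (\<lambda>x. \<bar>g x\<bar>))"
    using assms by (auto simp: l_infty_iff bdd_above_def)
  then show ?thesis unfolding sup_norm_def by (rule cSUP_upper[OF UNIV_I])
qed

section \<open>Positive functionals, and the norm condition as a value at 1\<close>

definition positive_functional :: "(('a \<Rightarrow> real) \<Rightarrow> real) \<Rightarrow> bool" where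
  "positive_functional \<mu> \<longleftrightarrow> linear_functional \<mu> \<and>
     (\<forall>g\<in>l_infty. (\<forall>x. 0 \<le> g x) \<longrightarrow> 0 \<le> \<mu> g)"

lemma positive_functional_add:
  "positive_functional \<mu> \<Longrightarrow> f \<in> l_infty \<Longrightarrow> g \<in> l_infty \<Longrightarrow> \<mu> (\<lambda>x. f x + g x) = \<mu> f + \<mu> g"
  by (simp add: positive_functional_def linear_functional_def)

lemma positive_functional_cmult:
  "positive_functional \<mu> \<Longrightarrow> g \<in> l_infty \<Longrightarrow> \<mu> (\<lambda>x. c * g x) = c * \<mu> g"
  by (simp add: positive_functional_def linear_functional_def)

lemma positive_functional_nonneg:
  "positive_functional \<mu> \<Longrightarrow> g \<in> l_infty \<Longrightarrow> (\<And>x. 0 \<le> g x) \<Longrightarrow> 0 \<le> \<mu> g"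
  by (simp add: positive_functional_def)

lemma positive_functional_mono:
  assumes \<mu>: "positive_functional \<mu>" and f: "f \<in> l_infty" and g: "g \<in> l_infty"
    and le: "\<And>x. f x \<le> g x"
  shows "\<mu> f \<le> \<mu> g"
proof -
  have m: "(\<lambda>x. (-1) * f x) \<in> l_infty" by (rule l_infty_cmult[OF f])
  have "0 \<le> \<mu> (\<lambda>x. g x + (-1) * f x)"
    by (rule positive_functional_nonneg[OF \<mu> l_infty_add[OF g m]]) (simp add: le)
  also have "\<dots> = \<mu> g - \<mu> f"
    using positive_functional_add[OF \<mu> g m] positive_functional_cmult[OF \<mu> f, of "-1"] by simp
  finally show ?thesis by simp
qed

text \<open>Monotonicity applied to \<open>- C \<le> g \<le> C\<close>.\<close>

lemma positive_functional_abs_le: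
  assumes \<mu>: "positive_functional \<mu>" and g: "g \<in> l_infty" and C: "\<And>x. \<bar>g x\<bar> \<le> C"
  shows "\<bar>\<mu> g\<bar> \<le> C * \<mu> (\<lambda>x. 1)"
proof -
  have c: "\<mu> (\<lambda>x. c) = c * \<mu> (\<lambda>x. 1)" for c
    using positive_functional_cmult[OF \<mu> l_infty_const[of 1], of c] by simp
  have "\<mu> g \<le> \<mu> (\<lambda>x. C)"
    using C by (intro positive_functional_mono[OF \<mu> g]) (auto simp: abs_le_iff)
  moreover have "\<mu> (\<lambda>x. - C) \<le> \<mu> g"
    using C by (intro positive_functional_mono[OF \<mu> _ g]) (auto simp: abs_le_iff minus_le_iff)
  ultimately show ?thesis using c[of C] c[of "- C"] by simp
qed

text \<open>A positive functional has dual norm \<open>\<mu> (\<lambda>x. 1)\<close>: this value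
  bounds \<open>\<bar>\<mu> g\<bar>\<close> on the unit ball, and the constant 1 attains it. From
  here on the norm never has to be computed again.\<close>

lemma is_mean_iff: "is_mean \<mu> \<longleftrightarrow> positive_functional \<mu> \<and> \<mu> (\<lambda>x. 1) = 1"
proof -
  have "Sup {\<bar>\<mu> g\<bar> | g. g \<in> l_infty \<and> sup_norm g \<le> 1} = \<mu> (\<lambda>x. 1)"
    and "bdd_above {\<bar>\<mu> g\<bar> | g. g \<in> l_infty \<and> sup_norm g \<le> 1}"
    if \<mu>: "positive_functional \<mu>"
  proof -
    have le: "z \<le> \<mu> (\<lambda>x. 1)" if zin: "z \<in> {\<bar>\<mu> g\<bar> | g. g \<in> l_infty \<and> sup_norm g \<le> 1}" for z
    proof -
      obtain g where z: "z = \<bar>\<mu> g\<bar>" and g: "g \<in> l_infty" "sup_norm g \<le> 1"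
        using zin by blast
      have "\<bar>g x\<bar> \<le> 1" for x using abs_le_sup_norm[OF g(1), of x] g(2) by simp
      then show ?thesis using positive_functional_abs_le[OF \<mu> g(1), of 1] z by simp
    qed
    then show "bdd_above {\<bar>\<mu> g\<bar> | g. g \<in> l_infty \<and> sup_norm g \<le> 1}"
      by (rule bdd_aboveI)
    have "\<mu> (\<lambda>x. 1) = \<bar>\<mu> (\<lambda>x. 1)\<bar>"
      using positive_functional_nonneg[OF \<mu>, of "\<lambda>x. 1"] by simp
    moreover have "sup_norm (\<lambda>x. 1) \<le> 1" by (simp add: sup_norm_def)
    ultimately have "\<mu> (\<lambda>x. 1) \<in> {\<bar>\<mu> g\<bar> | g. g \<in> l_infty \<and> sup_norm g \<le> 1}"
      using l_infty_const by blast
    then show "Sup {\<bar>\<mu> g\<bar> | g. g \<in> l_infty \<and> sup_norm g \<le> 1} = \<mu> (\<lambda>x. 1)"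
      using le by (rule cSup_eq_maximum)
  qed
  then show ?thesis
    unfolding is_mean_def has_dual_norm_def positive_functional_def by auto
qed

lemma left_invariant_mean_iff:
  "left_invariant_mean \<mu> \<longleftrightarrow> positive_functional \<mu> \<and> \<mu> (\<lambda>x. 1) = 1 \<and>
     (\<forall>s. \<forall>g\<in>l_infty. \<mu> (\<lambda>x. g (s * x)) = \<mu> g)"
  by (simp add: left_invariant_mean_def is_mean_iff comp_def)

lemma mean_abs_le:
  "positive_functional \<mu> \<Longrightarrow> \<mu> (\<lambda>x. 1) = 1 \<Longrightarrow> g \<in> l_infty \<Longrightarrow> (\<And>x. \<bar>g x\<bar> \<le> C) \<Longrightarrow> \<bar>\<mu> g\<bar> \<le> C"
  using positive_functional_abs_le[of \<mu> g C] by simp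

section \<open>Transport of invariant means along a surjective homomorphism\<close>

lemma positive_functional_push:
  "positive_functional \<mu> \<Longrightarrow> positive_functional (\<lambda>g. \<mu> (\<lambda>x. g (f x)))"
  by (simp add: positive_functional_def linear_functional_def)

text \<open>By surjectivity every translation of the target is by some \<open>h s\<close>, and
  \<open>h s * h x = h (s * x)\<close> turns it into translation by \<open>s\<close> in the
  source.\<close>

lemma left_invariant_mean_push:
  assumes \<mu>: "left_invariant_mean \<mu>" and hom: "\<And>x y. h (x * y) = h x * h y" and "surj h"
  shows "left_invariant_mean (\<lambda>g. \<mu> (\<lambda>x. g (h x)))"
proof -
  have "\<mu> (\<lambda>x. g (t * h x)) = \<mu> (\<lambda>x. g (h x))" if g: "g \<in> l_infty" for g t
  proof -
    obtain s where t: "t = h s" using \<open>surj h\<close> by (meson surjD)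
    have "\<forall>s. \<forall>g\<in>l_infty. \<mu> (\<lambda>x. g (s * x)) = \<mu> g"
      using \<mu> by (simp add: left_invariant_mean_iff)
    from this[rule_format, of "\<lambda>x. g (h x)" s] show ?thesis
      using g by (simp add: hom t)
  qed
  then show ?thesis
    using \<mu> by (simp add: left_invariant_mean_iff positive_functional_push)
qed

text \<open>The outer \<open>l\<close> averages over the translating element \<open>s\<close>; the
  inner \<open>m\<close> evaluates each translate of \<open>f\<close>.\<close>

definition arens_product ::
  "(('a::semigroup_mult \<Rightarrow> real) \<Rightarrow> real) \<Rightarrow> (('a \<Rightarrow> real) \<Rightarrow> real) \<Rightarrow> ('a \<Rightarrow> real) \<Rightarrow> real" where
  "arens_product l m f = l (\<lambda>s. m (\<lambda>x. f (s * x)))"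

text \<open>By associativity, translating \<open>f\<close> by \<open>t\<close> translates the
  function of \<open>s\<close> seen by \<open>l\<close>, so invariance comes from \<open>l\<close>
  alone and \<open>m\<close> may be any mean.\<close>

lemma left_invariant_mean_arens_product:
  assumes l: "left_invariant_mean l" and m: "positive_functional m" "m (\<lambda>x. 1) = 1"
  shows "left_invariant_mean (arens_product l m)"
proof -
  have lp: "positive_functional l" and l1: "l (\<lambda>x. 1) = 1"
    and linv: "\<And>s g. g \<in> l_infty \<Longrightarrow> l (\<lambda>x. g (s * x)) = l g"
    using l by (auto simp: left_invariant_mean_iff)
  \<comment> \<open>The laws for \<open>l\<close> apply to bounded functions only; a mean preserves
    the bound \<open>C\<close> of \<open>f\<close>.\<close>
  have F: "(\<lambda>s. m (\<lambda>x. f (s * x))) \<in> l_infty" if f: "f \<in> l_infty" for f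
  proof -
    obtain C where "\<And>x. \<bar>f x\<bar> \<le> C" using f by (auto simp: l_infty_iff)
    then have "\<bar>m (\<lambda>x. f (s * x))\<bar> \<le> C" for s
      by (intro mean_abs_le[OF m]) (simp_all add: f)
    then show ?thesis by (auto simp: l_infty_iff)
  qed
  have "positive_functional (arens_product l m)"
    unfolding positive_functional_def linear_functional_def arens_product_def
    by (auto simp: positive_functional_add[OF m(1)] positive_functional_cmult[OF m(1)]
        positive_functional_add[OF lp] positive_functional_cmult[OF lp] F
        intro!: positive_functional_nonneg[OF lp] positive_functional_nonneg[OF m(1)])
  moreover have "arens_product l m (\<lambda>x. 1) = 1"
    by (simp add: arens_product_def m(2) l1)
  moreover have "arens_product l m (\<lambda>x. f (t * x)) = arens_product l m f" if "f \<in> l_infty" for f t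
    using linv[OF F[OF that], of t] by (simp add: arens_product_def mult.assoc)
  ultimately show ?thesis by (simp add: left_invariant_mean_iff)
qed

lemma left_invariant_mean_lift:
  fixes h :: "'s::semigroup_mult \<Rightarrow> 't::semigroup_mult"
  assumes am: "left_amenable TYPE('s)" and hom: "\<And>x y. h (x * y) = h x * h y" and "surj h"
    and \<nu>: "left_invariant_mean \<nu>"
  obtains \<mu> where "left_invariant_mean \<mu>" "\<And>g. g \<in> l_infty \<Longrightarrow> \<mu> (\<lambda>x. g (h x)) = \<nu> g"
proof -
  obtain l :: "('s \<Rightarrow> real) \<Rightarrow> real" where l: "left_invariant_mean l"
    using am by (auto simp: left_amenable_def)
  \<comment> \<open>The push-forward of \<open>\<nu>\<close> along the section \<open>inv h\<close>:
    a mean on the source that maps back to \<open>\<nu>\<close>, but with no reason to be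
    invariant.\<close>
  define m where "m = (\<lambda>f. \<nu> (\<lambda>t. f (inv h t)))"
  have \<nu>': "positive_functional \<nu>" "\<nu> (\<lambda>x. 1) = 1"
    and inv: "\<And>s g. g \<in> l_infty \<Longrightarrow> \<nu> (\<lambda>x. g (s * x)) = \<nu> g"
    using \<nu> by (auto simp: left_invariant_mean_iff)
  have "positive_functional m" "m (\<lambda>x. 1) = 1"
    using \<nu>' by (simp_all add: m_def positive_functional_push)
  then have "left_invariant_mean (arens_product l m)"
    by (rule left_invariant_mean_arens_product[OF l])
  moreover have "arens_product l m (\<lambda>x. g (h x)) = \<nu> g" if g: "g \<in> l_infty" for g
  proof -
    \<comment> \<open>Since \<open>h (s * inv h t) = h s * t\<close>, invariance of
      \<open>\<nu>\<close> makes the inner value \<open>\<nu> g\<close> for every \<open>s\<close>.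
      The factor 1 lets homogeneity of \<open>l\<close> evaluate this constant.\<close>
    have "arens_product l m (\<lambda>x. g (h x)) = l (\<lambda>s. \<nu> g * 1)"
      using g by (simp add: arens_product_def m_def hom surj_f_inv_f[OF \<open>surj h\<close>] inv)
    also have "\<dots> = \<nu> g"
      using l positive_functional_cmult[of l "\<lambda>s. 1" "\<nu> g"] by (simp add: left_invariant_mean_iff)
    finally show ?thesis .
  qed
  ultimately show thesis by (rule that)
qed

section \<open>Sets of positive Banach density\<close>

text \<open>Amenability makes the set of values nonempty and means bound it by 1, so its supremum is
  a genuine one and exceeds 0 exactly when some value does.\<close>

lemma banach_density_pos_iff:
  fixes A :: "'a::semigroup_mult set"
  assumes "left_amenable TYPE('a)"
  shows "banach_density A > 0 \<longleftrightarrow> (\<exists>\<mu>. left_invariant_mean \<mu> \<and> \<mu> (indicat_real A) > 0)"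
proof -
  let ?M = "{\<mu> (indicat_real A) | \<mu>. left_invariant_mean \<mu>}"
  have "\<bar>\<mu> (indicat_real A)\<bar> \<le> 1" if "left_invariant_mean \<mu>" for \<mu>
    using that by (intro mean_abs_le[of \<mu> "indicat_real A"])
      (simp_all add: left_invariant_mean_iff indicator_def)
  then have "bdd_above ?M" by (auto simp: bdd_above_def abs_le_iff)
  moreover have "?M \<noteq> {}" using assms by (auto simp: left_amenable_def)
  ultimately show ?thesis by (auto simp: banach_density_def less_cSup_iff)
qed

lemma banach_density_pos_mono:
  fixes A :: "'a::semigroup_mult set"
  assumes am: "left_amenable TYPE('a)" and "A \<subseteq> B" "banach_density A > 0"
  shows "banach_density B > 0"
proof -
  obtain \<mu> where \<mu>: "left_invariant_mean \<mu>" "\<mu> (indicat_real A) > 0"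
    using assms by (auto simp: banach_density_pos_iff)
  have "\<mu> (indicat_real A) \<le> \<mu> (indicat_real B)"
    using \<mu>(1) \<open>A \<subseteq> B\<close>
    by (intro positive_functional_mono[of \<mu> "indicat_real A" "indicat_real B"])
      (auto simp: left_invariant_mean_iff indicator_def)
  then show ?thesis using \<mu> by (auto simp: banach_density_pos_iff[OF am])
qed

text \<open>One mean witnessing the union is subadditive on indicators, so it also witnesses one of
  the two sets. With monotonicity, this makes sets of non-positive density closed under subsets and
  finite unions.\<close>

lemma banach_density_pos_Un:
  fixes A :: "'a::semigroup_mult set"
  assumes am: "left_amenable TYPE('a)" and pos: "banach_density (A \<union> B) > 0"
  shows "banach_density A > 0 \<or> banach_density B > 0"
proof -
  obtain \<mu> where \<mu>: "left_invariant_mean \<mu>" "\<mu> (indicat_real (A \<union> B)) > 0"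
    using pos by (auto simp: banach_density_pos_iff[OF am])
  have p: "positive_functional \<mu>" using \<mu>(1) by (simp add: left_invariant_mean_iff)
  have "\<mu> (indicat_real (A \<union> B)) \<le> \<mu> (\<lambda>x. indicat_real A x + indicat_real B x)"
    by (intro positive_functional_mono[OF p] l_infty_add l_infty_indicator)
      (auto simp: indicator_def)
  also have "\<dots> = \<mu> (indicat_real A) + \<mu> (indicat_real B)"
    by (simp add: positive_functional_add[OF p])
  finally have "\<mu> (indicat_real A) > 0 \<or> \<mu> (indicat_real B) > 0" using \<mu>(2) by linarith
  then show ?thesis using \<mu>(1) by (auto simp: banach_density_pos_iff[OF am])
qed

section \<open>Banach density under surjective homomorphisms\<close>

lemma left_amenable_image:
  fixes h :: "'s::semigroup_mult \<Rightarrow> 't::semigroup_mult"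
  assumes "left_amenable TYPE('s)" "\<And>x y. h (x * y) = h x * h y" "surj h"
  shows "left_amenable TYPE('t)"
  using assms(1) left_invariant_mean_push[of _ h, OF _ assms(2,3)]
  unfolding left_amenable_def by blast

text \<open>A witnessing mean is pushed forward in one direction and lifted in the other; both keep
  the value on the indicator.\<close>

lemma banach_density_vimage_pos_iff:
  fixes h :: "'s::semigroup_mult \<Rightarrow> 't::semigroup_mult"
  assumes am: "left_amenable TYPE('s)" and hom: "\<And>x y. h (x * y) = h x * h y" and sj: "surj h"
  shows "banach_density (h -` B) > 0 \<longleftrightarrow> banach_density B > 0"
proof -
  have eq: "indicat_real (h -` B) = (\<lambda>x. indicat_real B (h x))"
    by (simp add: fun_eq_iff indicator_def)
  note amT = left_amenable_image[OF am hom sj]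
  show ?thesis
    unfolding banach_density_pos_iff[OF am] banach_density_pos_iff[OF amT] eq
  proof
    assume "\<exists>\<mu>. left_invariant_mean \<mu> \<and> 0 < \<mu> (\<lambda>x. indicat_real B (h x))"
    then show "\<exists>\<nu>. left_invariant_mean \<nu> \<and> 0 < \<nu> (indicat_real B)"
      using left_invariant_mean_push[OF _ hom sj] by blast
  next
    assume "\<exists>\<nu>. left_invariant_mean \<nu> \<and> 0 < \<nu> (indicat_real B)"
    then obtain \<nu> where \<nu>: "left_invariant_mean \<nu>" "0 < \<nu> (indicat_real B)" by blast
    obtain \<mu> where "left_invariant_mean \<mu>" "\<And>g. g \<in> l_infty \<Longrightarrow> \<mu> (\<lambda>x. g (h x)) = \<nu> g"
      using left_invariant_mean_lift[OF am hom sj \<nu>(1)] by blast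
    then show "\<exists>\<mu>. left_invariant_mean \<mu> \<and> 0 < \<mu> (\<lambda>x. indicat_real B (h x))"
      using \<nu>(2) by (intro exI[of _ \<mu>]) simp
  qed
qed

section \<open>Ultrafilters\<close>

lemma ultrafilter_exists:
  fixes F :: "'a filter"
  assumes "F \<noteq> bot"
  obtains p where "p \<in> beta" "p \<le> F"
proof -
  let ?A = "{G. G \<noteq> bot \<and> G \<le> F}"
  have "\<exists>p\<in>?A. \<forall>q\<in>?A. q \<le> p \<longrightarrow> q = p"
  \<comment> \<open>The order is reversed, so a maximal element is a finest proper filter and the
    infimum of a chain is its upper bound.\<close>
  proof (rule predicate_Zorn[of ?A "\<lambda>x y. y \<le> x"])
    show "partial_order_on ?A (relation_of (\<lambda>x y. y \<le> x) ?A)"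
      by (rule partial_order_on_relation_ofI) auto
  next
    fix C assume C: "C \<in> Chains (relation_of (\<lambda>x y. y \<le> x) ?A)"
    then have sub: "C \<subseteq> ?A" by (auto simp: Chains_def relation_of_def)
    show "\<exists>u\<in>?A. \<forall>a\<in>C. u \<le> a"
    proof (cases "C = {}")
      case True
      then show ?thesis using assms by auto
    next
      case False
      have "Inf C \<noteq> bot"
      proof
        assume "Inf C = bot"
        then have "eventually (\<lambda>x. False) (Inf C)" by simp
        \<comment> \<open>A chain is directed downwards, so whatever holds eventually in its infimum
          already does so in some member.\<close>
        moreover have "\<exists>x\<in>C. x \<le> inf a b" if "a \<in> C" "b \<in> C" for a b
          using C that by (fastforce simp: Chains_def relation_of_def)
        ultimately have "\<exists>b\<in>C. eventually (\<lambda>x. False) b"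
          using False by (simp add: eventually_Inf_base)
        then show False using sub by (auto simp: trivial_limit_def)
      qed
      moreover have "Inf C \<le> F"
      proof -
        obtain c where "c \<in> C" using False by blast
        then show ?thesis using sub Inf_lower[of c C] by (auto intro: order_trans)
      qed
      ultimately show ?thesis by (intro bexI[of _ "Inf C"]) (simp_all add: Inf_lower)
    qed
  qed
  then obtain p where p: "p \<noteq> bot" "p \<le> F"
    and "\<And>q. q \<noteq> bot \<Longrightarrow> q \<le> F \<Longrightarrow> q \<le> p \<Longrightarrow> q = p"
    by blast
  then have "p \<in> beta" using order_trans[of _ p F] by (auto simp: beta_def ultrafilter_def)
  then show thesis using p(2) that by blast
qed

section \<open>Lifting points of \<open>Delta_star\<close>\<close>

lemma Delta_star_lift:
  fixes h :: "'s::semigroup_mult \<Rightarrow> 't::semigroup_mult"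
  assumes am: "left_amenable TYPE('s)" and hom: "\<And>x y. h (x * y) = h x * h y" and sj: "surj h"
    and q: "q \<in> Delta_star"
  obtains p where "p \<in> Delta_star" "filtermap h p = q"
proof -
  \<comment> \<open>\<open>ev P\<close> says that \<open>P\<close> contains the preimage of a member
    of \<open>q\<close> up to a null set: the filter generated by these preimages and the
    complements of null sets.\<close>
  define ev where "ev = (\<lambda>P. \<exists>B. eventually (\<lambda>x. x \<in> B) q \<and> \<not> banach_density (h -` B - Collect P) > 0)"
  define F where "F = Abs_filter ev"
  have null_empty: "\<not> banach_density ({}::'s set) > 0"
  proof -
    have "indicat_real {} = (\<lambda>x::'s. 0)" by (simp add: fun_eq_iff)
    then show ?thesis
      using positive_functional_cmult[of _ "\<lambda>x::'s. 1" 0]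
      by (fastforce simp: banach_density_pos_iff[OF am] left_invariant_mean_iff)
  qed
  have "is_filter ev"
  proof
    show "ev (\<lambda>x. True)"
      unfolding ev_def using null_empty by (intro exI[of _ UNIV]) simp
  next
    fix P Q assume "ev P" "ev Q"
    then obtain B C where B: "eventually (\<lambda>x. x \<in> B) q" "\<not> banach_density (h -` B - Collect P) > 0"
      and C: "eventually (\<lambda>x. x \<in> C) q" "\<not> banach_density (h -` C - Collect Q) > 0"
      unfolding ev_def by blast
    have "h -` (B \<inter> C) - {x. P x \<and> Q x} \<subseteq> (h -` B - Collect P) \<union> (h -` C - Collect Q)" by auto
    then have "\<not> banach_density (h -` (B \<inter> C) - {x. P x \<and> Q x}) > 0"
      using B(2) C(2) banach_density_pos_mono[OF am] banach_density_pos_Un[OF am] by blast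
    moreover have "eventually (\<lambda>x. x \<in> B \<inter> C) q"
      using B(1) C(1) by (simp add: eventually_conj)
    ultimately show "ev (\<lambda>x. P x \<and> Q x)" unfolding ev_def by blast
  next
    fix P Q assume PQ: "\<forall>x. P x \<longrightarrow> Q x" and "ev P"
    then obtain B where B: "eventually (\<lambda>x. x \<in> B) q" "\<not> banach_density (h -` B - Collect P) > 0"
      unfolding ev_def by blast
    have "h -` B - Collect Q \<subseteq> h -` B - Collect P" using PQ by auto
    then show "ev Q" using B banach_density_pos_mono[OF am] unfolding ev_def by blast
  qed
  then have F: "eventually P F \<longleftrightarrow> ev P" for P by (simp add: F_def eventually_Abs_filter)
  have qpos: "banach_density B > 0" if "eventually (\<lambda>x. x \<in> B) q" for B
    using q that by (auto simp: Delta_star_def)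
  \<comment> \<open>Otherwise a member of \<open>q\<close> would have a null preimage, although it
    has positive density itself.\<close>
  have "F \<noteq> bot"
  proof
    assume "F = bot"
    then have "ev (\<lambda>x. False)" using F by (metis eventually_bot)
    then show False
      using qpos banach_density_vimage_pos_iff[OF am hom sj] by (auto simp: ev_def)
  qed
  then obtain p where p: "p \<in> beta" "p \<le> F" by (rule ultrafilter_exists)
  have "banach_density A > 0" if A: "eventually (\<lambda>x. x \<in> A) p" for A
  proof (rule ccontr)
    assume "\<not> banach_density A > 0"
    \<comment> \<open>With \<open>UNIV\<close> as the member of \<open>q\<close>, the complement of
      a null set \<open>A\<close> lies in \<open>F\<close>, hence in \<open>p\<close>.\<close>
    moreover have "h -` UNIV - {x. x \<notin> A} = A" by auto
    ultimately have "ev (\<lambda>x. x \<notin> A)" unfolding ev_def by (intro exI[of _ UNIV]) simp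
    then have "eventually (\<lambda>x. x \<notin> A) p" using F p(2) by (auto simp: le_filter_def)
    with A have "eventually (\<lambda>x. False) p" by (auto elim: eventually_elim2)
    then show False using p(1) by (simp add: beta_def ultrafilter_def trivial_limit_def)
  qed
  then have "p \<in> Delta_star" using p(1) by (simp add: Delta_star_def)
  moreover have "filtermap h p = q"
  proof -
    \<comment> \<open>Refinement suffices, because \<open>q\<close> is minimal among proper
      filters.\<close>
    have "filtermap h p \<le> q"
      unfolding le_filter_def eventually_filtermap
    proof (intro allI impI)
      fix P assume "eventually P q"
      then have "ev (\<lambda>x. P (h x))"
        unfolding ev_def using null_empty by (intro exI[of _ "Collect P"]) (simp add: vimage_def)
      then show "eventually (\<lambda>x. P (h x)) p" using F p(2) by (auto simp: le_filter_def)
    qed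
    then show ?thesis
      using q filtermap_in_beta[OF p(1), of h]
      by (auto simp: Delta_star_def beta_def ultrafilter_def)
  qed
  ultimately show thesis using that by blast
qed

theorem theorem3p6:
  fixes h :: "'s::semigroup_mult \<Rightarrow> 't::semigroup_mult"
  assumes "left_amenable TYPE('s)"
    and "\<And>x y. h (x * y) = h x * h y"
    and "surj h"
  shows "beta_ext h ` Delta_star = Delta_star"
proof
  show "beta_ext h ` Delta_star \<subseteq> Delta_star"
  proof (rule image_subsetI)
    fix p :: "'s filter" assume p: "p \<in> Delta_star"
    have "banach_density B > 0" if "eventually (\<lambda>x. x \<in> B) (filtermap h p)" for B
    proof -
      have "eventually (\<lambda>x. x \<in> h -` B) p" using that by (simp add: eventually_filtermap)
      then have "banach_density (h -` B) > 0" using p by (simp only: Delta_star_def) blast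
      then show ?thesis using banach_density_vimage_pos_iff[OF assms] by blast
    qed
    then show "beta_ext h p \<in> Delta_star"
      \<comment> \<open>On \<open>beta\<close> the continuous extension is
        \<open>filtermap h\<close>, so membership in the image point is membership of preimages in
        \<open>p\<close>.\<close>
      using p by (simp add: beta_ext_eq Delta_star_def filtermap_in_beta)
  qed
next
  show "Delta_star \<subseteq> beta_ext h ` Delta_star"
  proof
    fix q :: "'t filter" assume "q \<in> Delta_star"
    then obtain p where "p \<in> Delta_star" "filtermap h p = q"
      using Delta_star_lift[OF assms] by blast
    then show "q \<in> beta_ext h ` Delta_star"
      by (intro image_eqI[of _ _ p]) (simp_all add: beta_ext_eq Delta_star_def)
  qed
qed

end
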